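(* The function $\mathfrak{H}_{\mathbb{R}}:(\mathcal{COS}(\mathbb{R}),\tau_{ucc})\to\mathbb{R}_+\cup\{0\}$ given by the formula $$\mathfrak{H}_{\mathbb{R}}(x\mapsto\cos(2\pi yx)):=y$$ (where $y\in\mathbb{R}_+\cup\{0\}$) is a homeomorphism.
   Context: With $C^b(\mathbb{R})$ the space of bounded continuous functions $\mathbb{R}\to\mathbb{C}$, the cosine class is $$\mathcal{COS}(\mathbb{R}) := \left\{\phi\in C^b(\mathbb{R}) : \phi\neq 0,\ \forall_{x,y\in\mathbb{R}}\ \phi(x)\phi(y)=\frac{\phi(x+y)+\phi(x-y)}{2}\right\},$$ and $\tau_{ucc}$ is the topology of uniform convergence on compact subsets of $\mathbb{R}$. $\mathbb{R}_+\cup\{0\}=[0,\infty)$ carries its usual topology. *)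

theory Defs
  imports "HOL-Analysis.Analysis"
begin

text \<open>Uniform convergence on compact sets (ucc). For an arbitrary set \<open>F\<close> of functions the
  sets of all \<open>g\<close> with \<open>dist (g x) (f x) < e\<close> on \<open>K\<close> are neighbourhoods of \<open>f\<close> but need not be
  open, so openness is defined by neighbourhoods; \<open>limitin_ucc_topology\<close> identifies
  the resulting convergence.\<close>

definition openin_ucc ::
    "('a::topological_space \<Rightarrow> 'b::metric_space) set \<Rightarrow> ('a \<Rightarrow> 'b) set \<Rightarrow> bool" where
  "openin_ucc F U \<longleftrightarrow> U \<subseteq> F \<and>
     (\<forall>f\<in>U. \<exists>K e. compact K \<and> 0 < e \<and> {g \<in> F. \<forall>x\<in>K. dist (g x) (f x) < e} \<subseteq> U)"

definition ucc_topology ::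
    "('a::topological_space \<Rightarrow> 'b::metric_space) set \<Rightarrow> ('a \<Rightarrow> 'b) topology" where
  "ucc_topology F = topology (openin_ucc F)"

lemma istopology_openin_ucc: "istopology (openin_ucc F)"
  unfolding istopology_def
proof (intro conjI allI impI)
  fix S T assume S: "openin_ucc F S" and T: "openin_ucc F T"
  show "openin_ucc F (S \<inter> T)"
    unfolding openin_ucc_def
  proof (intro conjI ballI)
    show "S \<inter> T \<subseteq> F" using S unfolding openin_ucc_def by blast
    fix f assume "f \<in> S \<inter> T"
    then have f: "f \<in> S" "f \<in> T" by auto
    obtain K d where Kd: "compact K" "0 < d"
      and 1: "{g \<in> F. \<forall>x\<in>K. dist (g x) (f x) < d} \<subseteq> S"
      using S f(1) unfolding openin_ucc_def by blast
    obtain L e where Le: "compact L" "0 < e"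
      and 2: "{g \<in> F. \<forall>x\<in>L. dist (g x) (f x) < e} \<subseteq> T"
      using T f(2) unfolding openin_ucc_def by blast
    have "{g \<in> F. \<forall>x\<in>K \<union> L. dist (g x) (f x) < min d e} \<subseteq> S \<inter> T"
      using 1 2 by auto
    with Kd Le show "\<exists>K e. compact K \<and> 0 < e \<and>
        {g \<in> F. \<forall>x\<in>K. dist (g x) (f x) < e} \<subseteq> S \<inter> T"
      by (intro exI[of _ "K \<union> L"] exI[of _ "min d e"]) (simp add: compact_Un)
  qed
next
  fix \<U> assume \<U>: "\<forall>U\<in>\<U>. openin_ucc F U"
  show "openin_ucc F (\<Union>\<U>)"
    unfolding openin_ucc_def
  proof (intro conjI ballI)
    show "\<Union>\<U> \<subseteq> F" using \<U> unfolding openin_ucc_def by blast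
    fix f assume "f \<in> \<Union>\<U>"
    then obtain U where "U \<in> \<U>" "f \<in> U" by blast
    then have "openin_ucc F U" using \<U> by blast
    then obtain K e where Ke: "compact K" "0 < e"
      and sub: "{g \<in> F. \<forall>x\<in>K. dist (g x) (f x) < e} \<subseteq> U"
      using \<open>f \<in> U\<close> unfolding openin_ucc_def by blast
    have "{g \<in> F. \<forall>x\<in>K. dist (g x) (f x) < e} \<subseteq> \<Union>\<U>"
      using sub Union_upper[OF \<open>U \<in> \<U>\<close>] by (rule subset_trans)
    with Ke show "\<exists>K e. compact K \<and> 0 < e \<and>
        {g \<in> F. \<forall>x\<in>K. dist (g x) (f x) < e} \<subseteq> \<Union>\<U>" by (intro exI conjI)
  qed
qed

lemma openin_ucc_topology: "openin (ucc_topology F) U \<longleftrightarrow> openin_ucc F U"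
  by (simp add: ucc_topology_def istopology_openin_ucc)

lemma topspace_ucc_topology [simp]: "topspace (ucc_topology F) = F"
proof
  show "topspace (ucc_topology F) \<subseteq> F"
    by (auto simp: topspace_def openin_ucc_topology openin_ucc_def)
  have "openin (ucc_topology F) F"
    by (auto simp: openin_ucc_topology openin_ucc_def intro!: exI[of _ "{}"] exI[of _ "1::real"])
  then show "F \<subseteq> topspace (ucc_topology F)" by (rule openin_subset)
qed

lemma limitin_ucc_topology:
  "limitin (ucc_topology F) f l N \<longleftrightarrow>
     l \<in> F \<and> (\<forall>\<^sub>F n in N. f n \<in> F) \<and> (\<forall>K. compact K \<longrightarrow> uniform_limit K f l N)"
proof safe
  assume lim: "limitin (ucc_topology F) f l N"
  then show lF: "l \<in> F" by (simp add: limitin_def)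
  have "openin (ucc_topology F) F"
    using openin_topspace[of "ucc_topology F"] by simp
  then show "\<forall>\<^sub>F n in N. f n \<in> F" using lim lF unfolding limitin_def by blast
  fix K :: "'a set" assume K: "compact K"
  show "uniform_limit K f l N"
    unfolding uniform_limit_iff
  proof (intro allI impI)
    fix e :: real assume e: "0 < e"
    define U where "U = {g \<in> F. \<exists>r<e. \<forall>x\<in>K. dist (g x) (l x) \<le> r}"
    have "openin_ucc F U"
      unfolding openin_ucc_def
    proof (intro conjI ballI)
      show "U \<subseteq> F" by (auto simp: U_def)
      fix g assume "g \<in> U"
      then obtain r where r: "r < e" "\<forall>x\<in>K. dist (g x) (l x) \<le> r" by (auto simp: U_def)
      have "h \<in> U" if h: "h \<in> F" "\<forall>x\<in>K. dist (h x) (g x) < (e - r) / 2" for h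
      proof -
        have "dist (h x) (l x) \<le> (e + r) / 2" if x: "x \<in> K" for x
        proof -
          have "dist (h x) (l x) \<le> dist (h x) (g x) + dist (g x) (l x)" by (rule dist_triangle)
          also have "\<dots> \<le> (e - r) / 2 + r" using h(2) r(2) x by (intro add_mono) (auto intro: less_imp_le)
          finally show ?thesis by (simp add: field_simps)
        qed
        moreover have "(e + r) / 2 < e" using r(1) by simp
        ultimately show ?thesis using h(1) unfolding U_def by blast
      qed
      then show "\<exists>K e. compact K \<and> 0 < e \<and> {h \<in> F. \<forall>x\<in>K. dist (h x) (g x) < e} \<subseteq> U"
        using K r(1) by (intro exI[of _ K] exI[of _ "(e - r) / 2"]) auto
    qed
    moreover have "l \<in> U" using lF e by (auto simp: U_def)
    ultimately have "\<forall>\<^sub>F n in N. f n \<in> U"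
      using lim by (simp add: limitin_def openin_ucc_topology)
    then show "\<forall>\<^sub>F n in N. \<forall>x\<in>K. dist (f n x) (l x) < e"
      by eventually_elim (auto simp: U_def intro: le_less_trans)
  qed
next
  assume lF: "l \<in> F" and fF: "\<forall>\<^sub>F n in N. f n \<in> F"
    and ul: "\<forall>K. compact K \<longrightarrow> uniform_limit K f l N"
  show "limitin (ucc_topology F) f l N"
    unfolding limitin_def
  proof (intro conjI allI impI)
    show "l \<in> topspace (ucc_topology F)" using lF by simp
    fix U assume "openin (ucc_topology F) U \<and> l \<in> U"
    then obtain K e where "compact K" "0 < e"
      and U: "{g \<in> F. \<forall>x\<in>K. dist (g x) (l x) < e} \<subseteq> U"
      by (auto simp: openin_ucc_topology openin_ucc_def)
    then have "\<forall>\<^sub>F n in N. \<forall>x\<in>K. dist (f n x) (l x) < e"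
      using ul by (simp add: uniform_limit_iff)
    with fF show "\<forall>\<^sub>F n in N. f n \<in> U"
      by eventually_elim (use U in auto)
  qed
qed

definition COS :: "(real \<Rightarrow> complex) set" where
  "COS = {\<phi> \<in> bcontfun. \<phi> \<noteq> (\<lambda>_. 0) \<and>
            (\<forall>x y. \<phi> x * \<phi> y = (\<phi> (x + y) + \<phi> (x - y)) / 2)}"

definition cos_fun :: "real \<Rightarrow> real \<Rightarrow> complex" where
  "cos_fun y = (\<lambda>x. complex_of_real (cos (2 * pi * y * x)))"

text \<open>Meaningful only where exactly one such \<open>y\<close> exists; that this is so on all of
  \<^const>\<open>COS\<close> has to be established separately.\<close>

definition HH :: "(real \<Rightarrow> complex) \<Rightarrow> real" where
  "HH \<phi> = (THE y. 0 \<le> y \<and> \<phi> = cos_fun y)"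

end

theory Submission
  imports Defs
begin

text \<open>The functional equation determines \<open>\<phi>\<close> at all multiples of \<open>t\<close> from its value at
  \<open>t\<close>: writing \<open>\<phi> t = cos w\<close> with a complex \<open>w\<close>, which is always possible, gives
  \<open>\<phi> (n t) = cos (n w)\<close> (\<open>COS_multiple\<close>). Since \<open>\<bar>Im (n w)\<bar> \<le> \<bar>cos (n w)\<bar>\<close>, boundedness
  of \<open>\<phi>\<close> forces \<open>w\<close> to be real, so \<open>\<phi>\<close> takes only real values, in \<open>[-1, 1]\<close>
  (\<open>COS_real\<close>). As \<open>\<phi> 0 = 1\<close>, there is an interval \<open>[0, a]\<close> where \<open>\<phi>\<close> is positive;
  writing \<open>\<phi> a = cos w\<close> with \<open>0 \<le> w < \<pi> / 2\<close>, the half-angle formula with the positive root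
  gives \<open>\<phi> (a / 2^n) = cos (w / 2^n)\<close> (\<open>COS_halving\<close>). Taking multiples, \<open>\<phi> x\<close> and
  \<open>cos (w x / a)\<close> agree at the nonnegative dyadic multiples of \<open>a\<close>, hence everywhere by
  continuity and evenness (\<open>COS_imp_cos_fun\<close>).

  The map \<open>y \<mapsto> cos_fun y\<close> is continuous because the cosine is Lipschitz. Injectivity and
  continuity of the inverse both come from one quantitative fact, \<open>cos_fun_separation\<close>:
  the larger of two frequencies \<open>u < v\<close> reaches the value \<open>-1\<close> at \<open>x = 1 / (2 v)\<close>, where the
  smaller one still has the value \<open>cos (\<pi> u / v) > -1\<close>. If the frequencies are at least \<open>\<epsilon>\<close>
  apart, this \<open>x\<close> lies in the compact interval \<open>[0, 1 / (2 \<epsilon>)]\<close>, and the gap is bounded below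
  in terms of \<open>\<epsilon>\<close> and either one of the two frequencies, uniformly in the other one. This
  excludes, in particular, arbitrarily high frequencies near a given cosine function.\<close>

section \<open>Consequences of the cosine equation\<close>

lemma COS_I:
  assumes "\<phi> \<in> bcontfun" "\<phi> \<noteq> (\<lambda>_. 0)" "\<And>x y. \<phi> x * \<phi> y = (\<phi> (x + y) + \<phi> (x - y)) / 2"
  shows "\<phi> \<in> COS"
  using assms by (simp add: COS_def)

lemma COS_continuous: "\<phi> \<in> COS \<Longrightarrow> continuous_on UNIV \<phi>"
  by (simp add: COS_def bcontfun_def)

lemma COS_bounded: "\<phi> \<in> COS \<Longrightarrow> bounded (range \<phi>)"
  by (simp add: COS_def bcontfun_def)

lemma COS_add: "\<phi> \<in> COS \<Longrightarrow> \<phi> (x + y) = 2 * \<phi> x * \<phi> y - \<phi> (x - y)"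
  by (simp add: COS_def field_simps)

lemma COS_0:
  assumes "\<phi> \<in> COS"
  shows "\<phi> 0 = 1"
proof -
  obtain x where "\<phi> x \<noteq> 0"
    using assms by (fastforce simp: COS_def)
  with COS_add[OF assms, of x 0] show ?thesis
    by simp
qed

lemma COS_minus:
  assumes "\<phi> \<in> COS"
  shows "\<phi> (- x) = \<phi> x"
  using COS_add[OF assms, of 0 x] COS_0[OF assms] by simp

lemma COS_abs: "\<phi> \<in> COS \<Longrightarrow> \<phi> \<bar>x\<bar> = \<phi> x"
  by (simp add: abs_if COS_minus)

lemma COS_double: "\<phi> \<in> COS \<Longrightarrow> \<phi> (2 * x) = 2 * (\<phi> x)\<^sup>2 - 1"
  using COS_add[of \<phi> x x] by (simp add: COS_0 power2_eq_square)

text \<open>The cosine equation with \<open>y = t\<close> is a second-order recurrence for \<open>\<phi> (n t)\<close>, which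
  \<open>cos (n w)\<close> satisfies too. The angle \<open>w\<close> is complex because real values of \<open>\<phi>\<close> are only
  obtained from this lemma.\<close>

lemma COS_multiple:
  assumes "\<phi> \<in> COS" and "\<phi> t = cos w"
  shows "\<phi> (of_nat n * t) = cos (of_nat n * w)"
proof (induction n rule: induct_nat_012)
  case (ge2 n)
  have "\<phi> (of_nat (Suc (Suc n)) * t) = 2 * \<phi> (of_nat (Suc n) * t) * \<phi> t - \<phi> (of_nat n * t)"
    using COS_add[OF assms(1), of "of_nat (Suc n) * t" t] by (simp add: algebra_simps)
  also have "\<dots> = 2 * cos (of_nat (Suc n) * w) * cos w - cos (of_nat n * w)"
    using ge2 assms(2) by simp
  also have "\<dots> = cos (of_nat (Suc (Suc n)) * w)"
    using cos_times_cos[of "of_nat (Suc n) * w" w] by (simp add: algebra_simps)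
  finally show ?case .
qed (use assms COS_0 in auto)

text \<open>This holds because \<open>\<bar>cos z\<bar>\<^sup>2 = cos\<^sup>2 (Re z) + sinh\<^sup>2 (Im z)\<close> and
  \<open>\<bar>sinh s\<bar> \<ge> \<bar>s\<bar>\<close>.\<close>

lemma abs_Im_le_norm_cos: "\<bar>Im z\<bar> \<le> norm (cos z)"
proof -
  have "\<bar>Im z\<bar>\<^sup>2 \<le> \<bar>(exp (Im z) - inverse (exp (Im z))) / 2\<bar>\<^sup>2"
    by (intro power_mono real_le_abs_sinh) simp
  also have "\<dots> \<le> (norm (cos z))\<^sup>2"
    by (simp add: norm_cos_squared power_divide)
  finally show ?thesis
    using power2_le_imp_le norm_ge_zero by blast
qed

text \<open>Only here does boundedness enter: an angle with nonzero imaginary part would make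
  \<open>\<phi> (n t) = cos (n w)\<close> unbounded in \<open>n\<close>.\<close>

lemma COS_real:
  assumes "\<phi> \<in> COS"
  obtains c where "\<bar>c\<bar> \<le> 1" and "\<phi> t = of_real c"
proof -
  define w where "w = Arccos (\<phi> t)"
  have w: "\<phi> t = cos w"
    by (simp add: w_def)
  obtain B where B: "\<And>x. norm (\<phi> x) \<le> B"
    using COS_bounded[OF assms] by (auto simp: bounded_iff)
  have le: "of_nat n * \<bar>Im w\<bar> \<le> B" for n
  proof -
    have "of_nat n * \<bar>Im w\<bar> = \<bar>Im (of_nat n * w)\<bar>"
      by (simp add: abs_mult)
    also have "\<dots> \<le> norm (\<phi> (of_nat n * t))"
      unfolding COS_multiple[OF assms w] by (rule abs_Im_le_norm_cos)
    finally show ?thesis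
      using B order_trans by blast
  qed
  have "Im w = 0"
  proof (rule ccontr)
    assume "Im w \<noteq> 0"
    then obtain n where "B < of_nat n * \<bar>Im w\<bar>"
      using ex_less_of_nat_mult[of "\<bar>Im w\<bar>" B] by auto
    with le[of n] show False
      by simp
  qed
  then have "w = of_real (Re w)"
    by (simp add: complex_eq_iff)
  then have "\<phi> t = of_real (cos (Re w))"
    using w by (metis cos_of_real)
  then show thesis
    by (intro that[of "cos (Re w)"]) simp_all
qed

section \<open>Classification of the cosine class\<close>

lemma COS_positive_near_0:
  assumes "\<phi> \<in> COS"
  obtains a where "0 < a" and "\<And>x. \<bar>x\<bar> \<le> a \<Longrightarrow> 0 < Re (\<phi> x)"
proof -
  have "(\<lambda>x. Re (\<phi> x)) \<midarrow>0\<rightarrow> Re (\<phi> 0)"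
    using COS_continuous[OF assms] by (intro tendsto_Re) (simp add: continuous_on_def)
  then have "\<forall>\<^sub>F x in at 0. 0 < Re (\<phi> x)"
    by (rule order_tendstoD) (simp add: COS_0[OF assms])
  then obtain d where "0 < d" and d: "\<And>x. x \<noteq> 0 \<Longrightarrow> \<bar>x\<bar> < d \<Longrightarrow> 0 < Re (\<phi> x)"
    by (auto simp: eventually_at dist_real_def)
  show thesis
  proof (rule that[of "d / 2"])
    show "0 < Re (\<phi> x)" if "\<bar>x\<bar> \<le> d / 2" for x
      using d[of x] that \<open>0 < d\<close> by (cases "x = 0") (auto simp: COS_0[OF assms])
  qed (use \<open>0 < d\<close> in simp)
qed

text \<open>The double-angle formula determines \<open>\<phi> (t / 2)\<close> from \<open>\<phi> t\<close> up to sign. Positivity of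
  \<open>\<phi>\<close> on \<open>[0, a]\<close> and of the cosine on \<open>[0, w]\<close> selects the same sign on both sides.\<close>

lemma COS_halving:
  assumes "\<phi> \<in> COS" and "0 < a" and pos: "\<And>x. \<bar>x\<bar> \<le> a \<Longrightarrow> 0 < Re (\<phi> x)"
    and w: "0 \<le> w" "w < pi / 2" "\<phi> a = of_real (cos w)"
  shows "\<phi> (a / 2 ^ n) = of_real (cos (w / 2 ^ n))"
proof (induction n)
  case (Suc n)
  let ?t = "a / 2 ^ Suc n" and ?v = "w / 2 ^ Suc n"
  obtain c where c: "\<phi> ?t = of_real c"
    using COS_real[OF assms(1)] by blast
  have "of_real (2 * c\<^sup>2 - 1) = \<phi> (2 * ?t)"
    using COS_double[OF assms(1), of ?t] c by simp
  also have "\<dots> = of_real (cos (2 * ?v))"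
    using Suc by simp
  finally have "2 * c\<^sup>2 - 1 = cos (2 * ?v)"
    using of_real_eq_iff by blast
  then have "c\<^sup>2 = (cos ?v)\<^sup>2"
    unfolding cos_double_cos by linarith
  moreover have "0 < c"
  proof -
    have "\<bar>?t\<bar> \<le> a"
      using \<open>0 < a\<close> by (simp add: divide_le_eq self_le_ge2_pow mult_le_cancel_left1 del: power_Suc)
    then show ?thesis
      using pos[of ?t] c by simp
  qed
  moreover have "0 < cos ?v"
  proof (rule cos_gt_zero_pi)
    have "?v \<le> w"
      using w(1) by (simp add: divide_le_eq mult_le_cancel_left1 del: power_Suc)
    then show "?v < pi / 2"
      using w(2) by linarith
    show "- (pi / 2) < ?v"
      using w(1) pi_gt_zero by (smt (verit) divide_nonneg_pos zero_less_power pi_half_gt_zero)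
  qed
  ultimately have "c = cos ?v"
    by (simp add: power2_eq_iff_nonneg)
  with c show ?case
    by simp
qed (use w in simp)

lemma dyadic_approximation:
  assumes "0 \<le> (t::real)"
  shows "(\<lambda>n. of_nat (nat \<lfloor>2 ^ n * t\<rfloor>) / 2 ^ n) \<longlonglongrightarrow> t"
proof (rule tendsto_sandwich)
  show "\<forall>\<^sub>F n in sequentially. t - (1 / 2) ^ n \<le> of_nat (nat \<lfloor>2 ^ n * t\<rfloor>) / 2 ^ n"
  proof (intro always_eventually allI)
    fix n
    have "2 ^ n * t - 1 \<le> real (nat \<lfloor>2 ^ n * t\<rfloor>)"
      by linarith
    then have "(2 ^ n * t - 1) / 2 ^ n \<le> of_nat (nat \<lfloor>2 ^ n * t\<rfloor>) / 2 ^ n"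
      by (intro divide_right_mono) auto
    then show "t - (1 / 2) ^ n \<le> of_nat (nat \<lfloor>2 ^ n * t\<rfloor>) / 2 ^ n"
      by (simp add: diff_divide_distrib power_one_over)
  qed
  show "\<forall>\<^sub>F n in sequentially. of_nat (nat \<lfloor>2 ^ n * t\<rfloor>) / 2 ^ n \<le> t"
    using assms by (intro always_eventually allI) (simp add: divide_le_eq mult.commute)
  have "(\<lambda>n. t - (1 / 2) ^ n) \<longlonglongrightarrow> t - 0"
    by (intro tendsto_intros LIMSEQ_power_zero) simp
  then show "(\<lambda>n. t - (1 / 2) ^ n) \<longlonglongrightarrow> t"
    by simp
qed simp

text \<open>Halving and then taking multiples fixes \<open>\<phi>\<close> on a dense subset of \<open>[0, \<infinity>)\<close>, which
  continuity and evenness extend to the whole line.\<close>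

lemma COS_imp_cos_fun:
  assumes "\<phi> \<in> COS"
  shows "\<exists>y\<ge>0. \<phi> = cos_fun y"
proof -
  obtain a where a: "0 < a" "\<And>x. \<bar>x\<bar> \<le> a \<Longrightarrow> 0 < Re (\<phi> x)"
    using COS_positive_near_0[OF assms] by blast
  obtain c where c: "\<bar>c\<bar> \<le> 1" "\<phi> a = of_real c"
    using COS_real[OF assms] by blast
  (* c > 0 makes the angle w smaller than pi / 2, as halving requires *)
  have "0 < c"
    using a(2)[of a] a(1) c(2) by simp
  define w where "w = arccos c"
  have w: "0 \<le> w" "w < pi / 2" "\<phi> a = of_real (cos w)"
    using c \<open>0 < c\<close> arccos_less_arccos[of 0 c]
    by (auto simp: w_def arccos_lbound cos_arccos_abs)
  (* chosen so that 2 * pi * y * a = w *)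
  define y where "y = w / (2 * pi * a)"
  have "0 \<le> y"
    using w(1) a(1) by (simp add: y_def)
  have grid: "\<phi> (of_nat k / 2 ^ n * a) = cos_fun y (of_nat k / 2 ^ n * a)" for k n
  proof -
    have "\<phi> (a / 2 ^ n) = cos (of_real (w / 2 ^ n))"
      using COS_halving[OF assms a w] by (simp only: cos_of_real)
    then have "\<phi> (of_nat k * (a / 2 ^ n)) = cos (of_nat k * of_real (w / 2 ^ n))"
      by (rule COS_multiple[OF assms])
    also have "\<dots> = of_real (cos (of_nat k * (w / 2 ^ n)))"
      by (metis cos_of_real of_real_mult of_real_of_nat_eq)
    finally show ?thesis
      using a(1) by (simp add: cos_fun_def y_def mult.commute)
  qed
  have nonneg: "\<phi> x = cos_fun y x" if "0 \<le> x" for x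
  proof -
    let ?s = "\<lambda>n. of_nat (nat \<lfloor>2 ^ n * (x / a)\<rfloor>) / 2 ^ n * a"
    have "?s \<longlonglongrightarrow> x / a * a"
      using that a(1) by (intro tendsto_mult_right dyadic_approximation) simp
    then have s: "?s \<longlonglongrightarrow> x"
      using a(1) by simp
    have "isCont \<phi> x"
      using COS_continuous[OF assms] by (simp add: continuous_on_eq_continuous_at)
    then have "(\<lambda>n. \<phi> (?s n)) \<longlonglongrightarrow> \<phi> x"
      using s by (rule isCont_tendsto_compose)
    moreover have "isCont (cos_fun y) x"
      unfolding cos_fun_def by (intro continuous_intros)
    then have "(\<lambda>n. cos_fun y (?s n)) \<longlonglongrightarrow> cos_fun y x"
      using s by (rule isCont_tendsto_compose)
    ultimately show ?thesis
      unfolding grid by (rule LIMSEQ_unique)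
  qed
  have "\<phi> x = cos_fun y x" for x
    using nonneg[of "\<bar>x\<bar>"] COS_abs[OF assms] by (auto simp: cos_fun_def abs_if split: if_splits)
  with \<open>0 \<le> y\<close> show ?thesis
    by blast
qed

lemma cos_fun_in_COS: "cos_fun y \<in> COS"
proof (rule COS_I)
  have "bounded (range (cos_fun y))"
    by (auto simp: bounded_iff cos_fun_def intro!: exI[of _ 1])
  moreover have "continuous_on UNIV (cos_fun y)"
    unfolding cos_fun_def by (intro continuous_intros)
  ultimately show "cos_fun y \<in> bcontfun"
    by (simp add: bcontfun_def)
  have "cos_fun y 0 = 1"
    by (simp add: cos_fun_def)
  then show "cos_fun y \<noteq> (\<lambda>_. 0)"
    by auto
  show "cos_fun y x * cos_fun y z = (cos_fun y (x + z) + cos_fun y (x - z)) / 2" for x z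
    unfolding cos_fun_def of_real_mult[symmetric] cos_times_cos
    by (simp add: algebra_simps)
qed

section \<open>Separation of frequencies\<close>

lemma cos_fun_dist: "dist (cos_fun y x) (cos_fun z x) = \<bar>cos (2 * pi * y * x) - cos (2 * pi * z * x)\<bar>"
  unfolding cos_fun_def by (simp add: dist_of_real dist_real_def)

text \<open>Neither the interval nor the lower bound depends on \<open>y\<close>: together they describe one
  neighbourhood of \<open>cos_fun z\<close> that excludes every frequency at distance at least \<open>\<epsilon>\<close> from \<open>z\<close>.
  The witness is the first positive zero \<open>x\<close> of \<open>cos (2 \<pi> v x) + 1\<close> for the larger frequency \<open>v\<close>; it
  is at most \<open>1 / (2 \<epsilon>)\<close> since \<open>v \<ge> \<epsilon>\<close>. The bound is uniform because the ratio of the smaller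
  to the larger frequency is at most \<open>z / (z + \<epsilon>)\<close>, whichever of the two is \<open>z\<close>.\<close>

lemma cos_fun_separation:
  assumes "0 \<le> z" "0 \<le> y" "0 < \<epsilon>" "\<epsilon> \<le> \<bar>y - z\<bar>"
  shows "\<exists>x\<in>{0..1 / (2 * \<epsilon>)}. 1 + cos (pi * (z / (z + \<epsilon>))) \<le> dist (cos_fun y x) (cos_fun z x)"
proof -
  define u v where "u = min y z" and "v = max y z"
  have uv: "0 \<le> u" "u \<le> z" "u + \<epsilon> \<le> v"
    using assms by (auto simp: u_def v_def)
  define x where "x = 1 / (2 * v)"
  have "u / v \<le> u / (u + \<epsilon>)"
    using uv assms(3) by (intro divide_left_mono mult_pos_pos) auto
  also have "\<dots> \<le> z / (z + \<epsilon>)"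
    using uv assms by (simp add: frac_le_eq field_simps)
  finally have ratio: "u / v \<le> z / (z + \<epsilon>)" .
  have "1 + cos (pi * (z / (z + \<epsilon>))) \<le> 1 + cos (pi * (u / v))"
    using uv assms ratio
    by (intro add_left_mono cos_monotone_0_pi_le mult_left_mono) (auto simp: field_simps)
  also have "\<dots> = \<bar>cos (2 * pi * u * x) - cos (2 * pi * v * x)\<bar>"
  proof -
    have "2 * pi * u * x = pi * (u / v)" and "2 * pi * v * x = pi"
      using uv assms(3) by (simp_all add: x_def)
    then show ?thesis
      using cos_ge_minus_one[of "pi * (u / v)"] by (simp only: cos_pi)
  qed
  also have "\<dots> = dist (cos_fun y x) (cos_fun z x)"
    unfolding cos_fun_dist u_def v_def by (auto simp: min_def max_def)
  finally have "1 + cos (pi * (z / (z + \<epsilon>))) \<le> dist (cos_fun y x) (cos_fun z x)" .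
  moreover have "x \<in> {0..1 / (2 * \<epsilon>)}"
    using uv assms(3) by (auto simp: x_def intro!: divide_left_mono)
  ultimately show ?thesis
    by blast
qed

lemma separation_constant_pos:
  assumes "0 \<le> z" "0 < \<epsilon>"
  shows "0 < 1 + cos (pi * (z / (z + \<epsilon>)))"
proof -
  have "cos pi < cos (pi * (z / (z + \<epsilon>)))"
    using assms by (intro cos_monotone_0_pi) (auto simp: field_simps)
  then show ?thesis
    by simp
qed

lemma cos_fun_inj:
  assumes "0 \<le> y" "0 \<le> z" "cos_fun y = cos_fun z"
  shows "y = z"
proof (rule ccontr)
  assume "y \<noteq> z"
  then have "0 < \<bar>y - z\<bar>"
    by simp
  with cos_fun_separation[OF assms(2,1) this order_refl] separation_constant_pos[OF assms(2) this]
  show False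
    using assms(3) by auto
qed

lemma HH_cos_fun: "0 \<le> y \<Longrightarrow> HH (cos_fun y) = y"
  unfolding HH_def by (rule the_equality) (auto dest: cos_fun_inj)

lemma HH_nonneg: "\<phi> \<in> COS \<Longrightarrow> 0 \<le> HH \<phi>"
  and cos_fun_HH: "\<phi> \<in> COS \<Longrightarrow> cos_fun (HH \<phi>) = \<phi>"
  using COS_imp_cos_fun HH_cos_fun by force+

section \<open>Continuity in both directions\<close>

lemma uniform_limit_cos_fun:
  assumes "compact K"
  shows "uniform_limit K cos_fun (cos_fun z) (at z within S)"
proof (rule uniform_limitI)
  fix e :: real
  assume "0 < e"
  obtain R where R: "0 < R" "\<And>x. x \<in> K \<Longrightarrow> \<bar>x\<bar> \<le> R"
    using compact_imp_bounded[OF assms] by (auto simp: bounded_pos)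
  have lip: "dist (cos_fun y x) (cos_fun z x) \<le> 2 * pi * R * dist y z" if "x \<in> K" for x y
  proof -
    let ?p = "2 * pi * y * x" and ?q = "2 * pi * z * x"
    have "dist (cos_fun y x) (cos_fun z x) = 2 * \<bar>sin ((?p + ?q) / 2)\<bar> * \<bar>sin ((?q - ?p) / 2)\<bar>"
      unfolding cos_fun_dist cos_diff_cos abs_mult by simp
    also have "\<dots> \<le> 2 * 1 * \<bar>(?q - ?p) / 2\<bar>"
      by (intro mult_mono abs_sin_x_le_abs_x) auto
    also have "\<dots> = 2 * pi * \<bar>x\<bar> * dist y z"
    proof -
      have "?q - ?p = 2 * pi * x * (z - y)"
        by (simp add: algebra_simps)
      then show ?thesis
        by (simp add: abs_mult dist_real_def abs_minus_commute)
    qed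
    also have "\<dots> \<le> 2 * pi * R * dist y z"
      using R(2)[OF that] by (intro mult_mono) auto
    finally show ?thesis .
  qed
  have "\<forall>\<^sub>F y in at z within S. dist y z < e / (2 * pi * R)"
    using \<open>0 < e\<close> R(1) by (intro tendstoD tendsto_ident_at) simp
  then show "\<forall>\<^sub>F y in at z within S. \<forall>x\<in>K. dist (cos_fun y x) (cos_fun z x) < e"
  proof eventually_elim
    case (elim y)
    then have "2 * pi * R * dist y z < e"
      using R(1) by (simp add: field_simps)
    with lip show ?case
      by (meson le_less_trans)
  qed
qed

abbreviation "COS_topology \<equiv> subtopology (ucc_topology bcontfun) COS"

lemma COS_subset_bcontfun: "COS \<subseteq> bcontfun"
  by (auto simp: COS_def)

lemma topspace_COS_topology: "topspace COS_topology = COS"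
  using COS_subset_bcontfun by auto

lemma continuous_map_cos_fun:
  "continuous_map (top_of_set {0..}) COS_topology cos_fun"
  unfolding continuous_map_atin
proof
  fix z :: real
  assume "z \<in> topspace (top_of_set {0..})"
  then have "atin (top_of_set {0..}) z = at z within {0..}"
    by (auto simp: filter_eq_iff eventually_atin_subtopology eventually_at_topological
        eventually_atin_within atin_subtopology_within)
  then show "limitin COS_topology cos_fun (cos_fun z) (atin (top_of_set {0..}) z)"
    using cos_fun_in_COS subsetD[OF COS_subset_bcontfun cos_fun_in_COS]
    by (auto simp: limitin_subtopology limitin_ucc_topology intro: uniform_limit_cos_fun)
qed

text \<open>Continuity of the identity turns convergence in the topology into uniform convergence on
  \<open>[0, 1 / (2 \<epsilon>)]\<close>, and there \<open>cos_fun_separation\<close> excludes frequencies at distance at least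
  \<open>\<epsilon>\<close>.\<close>

lemma continuous_map_HH:
  "continuous_map COS_topology (top_of_set {0..}) HH"
  unfolding continuous_map_atin topspace_COS_topology
proof
  fix \<phi>
  assume \<phi>: "\<phi> \<in> COS"
  let ?N = "atin COS_topology \<phi>"
  have "limitin COS_topology (\<lambda>\<psi>. \<psi>) \<phi> ?N"
    using continuous_map_id[of COS_topology] \<phi>
    unfolding continuous_map_atin topspace_COS_topology by (simp add: id_def)
  then have in_COS: "\<forall>\<^sub>F \<psi> in ?N. \<psi> \<in> COS"
    and unif: "\<And>K. compact K \<Longrightarrow> uniform_limit K (\<lambda>\<psi>. \<psi>) \<phi> ?N"
    by (simp_all add: limitin_subtopology limitin_ucc_topology)
  have "(HH \<longlongrightarrow> HH \<phi>) ?N"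
  proof (rule tendstoI)
    fix \<epsilon> :: real
    assume "0 < \<epsilon>"
    let ?z = "HH \<phi>"
    have "\<forall>\<^sub>F \<psi> in ?N. \<forall>x\<in>{0..1 / (2 * \<epsilon>)}. dist (\<psi> x) (\<phi> x) < 1 + cos (pi * (?z / (?z + \<epsilon>)))"
      using unif separation_constant_pos[OF HH_nonneg[OF \<phi>] \<open>0 < \<epsilon>\<close>]
      by (intro uniform_limitD) auto
    with in_COS show "\<forall>\<^sub>F \<psi> in ?N. dist (HH \<psi>) ?z < \<epsilon>"
    proof eventually_elim
      case (elim \<psi>)
      show ?case
      proof (rule ccontr)
        assume "\<not> dist (HH \<psi>) ?z < \<epsilon>"
        then have "\<epsilon> \<le> \<bar>HH \<psi> - ?z\<bar>"
          by (simp add: dist_real_def)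
        from cos_fun_separation[OF HH_nonneg[OF \<phi>] HH_nonneg[OF elim(1)] \<open>0 < \<epsilon>\<close> this]
        show False
          using elim by (force simp: cos_fun_HH \<phi>)
      qed
    qed
  qed
  moreover have "\<forall>\<^sub>F \<psi> in ?N. HH \<psi> \<in> {0..}"
    using in_COS by eventually_elim (simp add: HH_nonneg)
  ultimately show "limitin (top_of_set {0..}) HH (HH \<phi>) ?N"
    using HH_nonneg[OF \<phi>] by (simp add: limitin_subtopology)
qed

theorem theorem8:
  shows "(\<forall>y\<ge>0. cos_fun y \<in> COS) \<and>
         (\<forall>\<phi>\<in>COS. \<exists>!y. 0 \<le> y \<and> \<phi> = cos_fun y) \<and>
         (\<forall>y\<ge>0. HH (cos_fun y) = y) \<and>
         homeomorphic_map (subtopology (ucc_topology bcontfun) COS) (top_of_set {0..}) HH"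
proof (intro conjI allI ballI impI)
  show "cos_fun y \<in> COS" for y
    by (rule cos_fun_in_COS)
  show "\<exists>!y. 0 \<le> y \<and> \<phi> = cos_fun y" if "\<phi> \<in> COS" for \<phi>
    using COS_imp_cos_fun[OF that] cos_fun_inj by blast
  show "HH (cos_fun y) = y" if "0 \<le> y" for y
    using that by (rule HH_cos_fun)
  have "homeomorphic_maps COS_topology (top_of_set {0..}) HH cos_fun"
    unfolding homeomorphic_maps_def topspace_COS_topology
    using continuous_map_HH continuous_map_cos_fun by (simp add: cos_fun_HH HH_cos_fun)
  then show "homeomorphic_map COS_topology (top_of_set {0..}) HH"
    by (rule homeomorphic_maps_imp_map)
qed

end
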